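(* Let $\epsilon>0$ be arbitrarily given, and let $$F_\epsilon(x):=f(x)+\lambda\sum_{i=1}^n h_{u_\epsilon}(x_i),\qquad h_{u_\epsilon}(t):=\min_{0\le s\le u_\epsilon}p\left(|t|s-\frac{s^q}{q}\right),\qquad u_\epsilon:=\left(\frac{\epsilon}{\lambda n}\right)^{1/q}.$$ Then: (i) $0\le F_\epsilon(x)-F(x)\le\epsilon$ for every $x\in\mathbb{R}^n$. (ii) $F_\epsilon$ is locally Lipschitz continuous in $\mathbb{R}^n$. Furthermore, if $f$ is Lipschitz continuous, so is $F_\epsilon$. (iii) The Clarke subdifferential of $F_\epsilon$ exists at every $x\in\mathbb{R}^n$.
   Context: Here $\lambda>0$, $p\in(0,1)$, $q$ is defined by $\frac1p+\frac1q=1$ (so $q<0$), with the convention $0^\beta=\infty$ for $\beta<0$. The function $f:\mathbb{R}^n\to\mathbb{R}$ is continuously differentiable, bounded below on $\mathbb{R}^n$, and has $L_f$-Lipschitz continuous gradient: $\|\nabla f(x)-\nabla f(y)\|_2\le L_f\|x-y\|_2$ for all $x,y$. $F(x)=f(x)+\lambda\|x\|_p^p$ with $\|x\|_p^p=\sum_{i=1}^n|x_i|^p$. The Clarke subdifferential of a function at $x$ is Clarke's generalized gradient, which is defined ("exists") when the function is Lipschitz continuous near $x$. *)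

theory Defs
  imports "HOL-Analysis.Analysis"
begin

text \<open>The power \<open>s\<close> to the \<open>\<beta>\<close> for \<open>s \<ge> 0\<close>, extended-real valued because of the
  convention that \<open>0\<close> to a negative power is \<open>\<infinity>\<close> (whereas \<open>0 powr \<beta> = 0\<close>).\<close>

definition epowr :: "real \<Rightarrow> real \<Rightarrow> ereal" where
  "epowr s \<beta> = (if s = 0 \<and> \<beta> < 0 then \<infinity> else ereal (s powr \<beta>))"

definition h_obj :: "real \<Rightarrow> real \<Rightarrow> real \<Rightarrow> real \<Rightarrow> ereal" where
  "h_obj p q t s = ereal p * (ereal (\<bar>t\<bar> * s) - epowr s q / ereal q)"

text \<open>The minimum is taken in the extended reals, since the objective is \<open>\<infinity>\<close> at \<open>s = 0\<close> when
  \<open>0 < p\<close> and \<open>q < 0\<close>. For \<open>u > 0\<close> it is attained at some \<open>s > 0\<close>, so it is finite and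
  \<^const>\<open>real_of_ereal\<close> loses nothing.\<close>

definition h :: "real \<Rightarrow> real \<Rightarrow> real \<Rightarrow> real \<Rightarrow> real" where
  "h p q u t = real_of_ereal (LEAST v. v \<in> h_obj p q t ` {0..u})"

definition F :: "(real ^ 'n \<Rightarrow> real) \<Rightarrow> real \<Rightarrow> real \<Rightarrow> real ^ 'n \<Rightarrow> real" where
  "F f lam p x = f x + lam * (\<Sum>i\<in>UNIV. \<bar>x $ i\<bar> powr p)"

definition u_eps :: "nat \<Rightarrow> real \<Rightarrow> real \<Rightarrow> real \<Rightarrow> real" where
  "u_eps n lam q \<epsilon> = (\<epsilon> / (lam * real n)) powr (1 / q)"

definition F_eps ::
  "(real ^ 'n \<Rightarrow> real) \<Rightarrow> real \<Rightarrow> real \<Rightarrow> real \<Rightarrow> real \<Rightarrow> real ^ 'n \<Rightarrow> real" where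
  "F_eps f lam p q \<epsilon> x = f x + lam * (\<Sum>i\<in>UNIV. h p q (u_eps CARD('n) lam q \<epsilon>) (x $ i))"

definition lipschitz_near :: "('a::metric_space \<Rightarrow> real) \<Rightarrow> 'a \<Rightarrow> bool" where
  "lipschitz_near g x \<longleftrightarrow> (\<exists>e>0. \<exists>L. L-lipschitz_on (ball x e) g)"

text \<open>Clarke's generalized directional derivative: the upper limit of the difference quotients
  as \<open>y \<rightarrow> x\<close> (with \<open>y = x\<close> allowed) and \<open>t \<down> 0\<close> jointly.\<close>

definition clarke_deriv :: "('a::euclidean_space \<Rightarrow> real) \<Rightarrow> 'a \<Rightarrow> 'a \<Rightarrow> ereal" where
  "clarke_deriv g x v =
     Limsup (nhds x \<times>\<^sub>F at_right 0) (\<lambda>(y, t). ereal ((g (y + t *\<^sub>R v) - g y) / t))"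

text \<open>Clarke's generalized gradient is defined only for functions that are Lipschitz near the point;
  hence a relation: \<open>S\<close> is the Clarke subdifferential of \<open>g\<close> at \<open>x\<close>.\<close>

definition has_clarke_subdifferential ::
  "('a::euclidean_space \<Rightarrow> real) \<Rightarrow> 'a set \<Rightarrow> 'a \<Rightarrow> bool" where
  "has_clarke_subdifferential g S x \<longleftrightarrow>
     lipschitz_near g x \<and> S = {\<xi>. \<forall>v. ereal (\<xi> \<bullet> v) \<le> clarke_deriv g x v}"

end

theory Submission
  imports Defs
begin

text \<open>With \<open>a = u powr (q - 1)\<close>, Young's inequality shows that \<open>h p q u\<close> is \<open>\<bar>t\<bar> powr p\<close> for
  \<open>\<bar>t\<bar> \<ge> a\<close> and \<open>p * (\<bar>t\<bar> * u - u powr q / q)\<close> for \<open>\<bar>t\<bar> \<le> a\<close>; the gap to \<open>\<bar>t\<bar> powr p\<close> is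
  therefore at most \<open>u powr q\<close>, which is \<open>\<epsilon> / (lam * n)\<close> for \<open>u = u_eps n lam q \<epsilon>\<close>. As a minimum of functions that are Lipschitz in \<open>t\<close> with
  constant \<open>p * u\<close>, it is Lipschitz. The Clarke subdifferential is nonempty without any appeal to the
  Hahn-Banach theorem, because at every point \<open>h p q u\<close> is supported from below by a differentiable
  function, whose derivative yields a subgradient.\<close>

text \<open>The real-valued form of \<open>h_obj\<close>, faithful only for \<open>0 < s\<close>: at
  \<open>s = 0\<close> it takes the default value 0 instead of infinity. Hence the positivity
  hypotheses on \<open>s\<close> below.\<close>

definition h_real :: "real \<Rightarrow> real \<Rightarrow> real \<Rightarrow> real \<Rightarrow> real" where
  "h_real p q t s = p * (\<bar>t\<bar> * s - s powr q / q)"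

lemma DERIV_abs_real:
  fixes t :: real
  assumes "t \<noteq> 0"
  shows "(abs has_real_derivative sgn t) (at t)"
proof -
  define S where "S = (if 0 < t then {0<..} else {..<0::real})"
  have "((\<lambda>r. sgn t * r) has_real_derivative sgn t) (at t)"
    by (auto intro!: derivative_eq_intros)
  moreover have "open S" "t \<in> S" using assms by (auto simp: S_def)
  ultimately show ?thesis
    by (rule has_field_derivative_transform_within_open)
      (use assms in \<open>auto simp: S_def sgn_if split: if_splits\<close>)
qed

section \<open>Conjugate exponents and Young's inequality\<close>

locale conjugate_exponents =
  fixes p q :: real
  assumes p_pos: "0 < p" and p_less_1: "p < 1" and conj: "1 / p + 1 / q = 1"
begin

lemma q_eq: "q = p / (p - 1)"
proof -
  have "q \<noteq> 0" using conj p_less_1 p_pos by (auto simp: field_simps)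
  then have "q * (p - 1) = p" using conj p_pos by (simp add: field_simps)
  then show ?thesis using p_less_1 by (simp add: field_simps)
qed

lemma q_neg: "q < 0"
  using p_pos p_less_1 by (simp add: q_eq divide_pos_neg)

lemma p_div_q: "p / q = p - 1"
  using p_pos by (simp add: q_eq)

lemma q_minus_1: "q - 1 = 1 / (p - 1)"
  using p_less_1 by (simp add: q_eq field_simps)

text \<open>Since \<open>(q - 1) * (p - 1) = 1\<close>, the powers with exponents
  \<open>q - 1\<close> and \<open>p - 1\<close> are mutually inverse on the positive reals. They
  translate between a slope \<open>s\<close> and the value of \<open>\<bar>t\<bar>\<close> at which
  it is optimal.\<close>

lemma powr_conj: "(s powr (q - 1)) powr (p - 1) = s" if "0 < s" for s :: real
  using that p_less_1 by (simp add: powr_powr q_minus_1)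

lemma powr_conj_p: "(s powr (q - 1)) powr p = s powr q" for s :: real
  using p_less_1 by (simp add: powr_powr q_minus_1) (simp add: q_eq)

text \<open>By \<open>p / q = p - 1\<close> the coefficients become the convex weights
  \<open>p\<close> and \<open>1 - p\<close> of Young's inequality.\<close>

lemma h_real_alt: "h_real p q t s = p * \<bar>t\<bar> * s + (1 - p) * s powr q"
proof -
  have "h_real p q t s = p * \<bar>t\<bar> * s - (p / q) * s powr q"
    by (simp add: h_real_def algebra_simps)
  then show ?thesis by (simp add: p_div_q algebra_simps)
qed

lemma powr_le_h_real:
  assumes "0 < s"
  shows "\<bar>t\<bar> powr p \<le> h_real p q t s"
proof (cases "t = 0")
  case True
  then show ?thesis using p_less_1 by (simp add: h_real_alt)
next
  case False
  \<comment> \<open>\<open>r\<close> is the value of \<open>\<bar>t\<bar>\<close> for which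
    \<open>s\<close> is optimal. Young's inequality is applied to \<open>\<bar>t\<bar> / r\<close>
    and 1, with equality at \<open>\<bar>t\<bar> = r\<close>, and then scaled by
    \<open>r powr p = s powr q\<close>.\<close>
  define r where "r = s powr (q - 1)"
  have r: "r > 0" "s = r powr (p - 1)" "s powr q = r powr p"
    using assms by (simp_all add: r_def powr_conj powr_conj_p)
  have "(\<bar>t\<bar> / r) powr p * 1 powr (1 - p) \<le> p * (\<bar>t\<bar> / r) + (1 - p) * 1"
    using p_pos p_less_1 r False by (intro Youngs_inequality_0) auto
  then have "\<bar>t\<bar> powr p \<le> (p * (\<bar>t\<bar> / r) + (1 - p)) * r powr p"
    using r(1) by (simp add: powr_divide divide_le_eq)
  also have "\<dots> = h_real p q t s"
    using r(1) by (simp add: h_real_alt r(3)) (simp add: r(2) powr_diff field_simps)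
  finally show ?thesis .
qed

text \<open>The equality case of Young's inequality: \<open>\<bar>t\<bar> powr (p - 1)\<close> is
  the unconstrained minimizer.\<close>

lemma h_real_eq_powr:
  assumes "t \<noteq> 0"
  shows "h_real p q t (\<bar>t\<bar> powr (p - 1)) = \<bar>t\<bar> powr p"
proof -
  have "(\<bar>t\<bar> powr (p - 1)) powr q = \<bar>t\<bar> powr p"
    using p_less_1 by (simp add: powr_powr q_eq)
  moreover have "\<bar>t\<bar> * \<bar>t\<bar> powr (p - 1) = \<bar>t\<bar> powr p"
    using assms by (simp add: powr_diff)
  ultimately show ?thesis by (simp add: h_real_alt mult.assoc algebra_simps)
qed

text \<open>No derivative in \<open>s\<close> is needed. At \<open>a = u powr (q - 1)\<close> the
  point \<open>u\<close> minimizes over all positive \<open>s\<close>; passing from \<open>a\<close>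
  to \<open>\<bar>t\<bar>\<close> subtracts \<open>p * (a - \<bar>t\<bar>) * s\<close>, which is
  largest at the larger slope \<open>u\<close>.\<close>

lemma h_real_antimono:
  assumes "0 < s" "s \<le> u" "\<bar>t\<bar> \<le> u powr (q - 1)"
  shows "h_real p q t u \<le> h_real p q t s"
proof -
  define a where "a = u powr (q - 1)"
  have u: "u > 0" and a: "a > 0" using assms by (auto simp: a_def)
  have "h_real p q a u = \<bar>a\<bar> powr p"
    using h_real_eq_powr[of a] a u by (simp add: a_def powr_conj)
  also have "\<dots> \<le> h_real p q a s"
    by (rule powr_le_h_real) fact
  finally have "p * a * u + (1 - p) * u powr q \<le> p * a * s + (1 - p) * s powr q"
    using a by (simp add: h_real_alt)
  moreover have "p * (a - \<bar>t\<bar>) * s \<le> p * (a - \<bar>t\<bar>) * u"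
    using assms p_pos by (intro mult_left_mono) (auto simp: a_def)
  ultimately show ?thesis by (simp add: h_real_alt algebra_simps)
qed

section \<open>From the extended-real minimum to a closed form of \<open>h\<close>\<close>

lemma h_obj_eq: "0 < s \<Longrightarrow> h_obj p q t s = ereal (h_real p q t s)"
  using q_neg by (simp add: h_obj_def epowr_def h_real_def)

lemma h_obj_0: "h_obj p q t 0 = \<infinity>"
  using q_neg p_pos by (simp add: h_obj_def epowr_def divide_ereal_def)

text \<open>The competitor \<open>r = 0\<close> can be ignored because the objective is infinite
  there.\<close>

lemma h_eqI:
  assumes "0 < s" "s \<le> u" and "\<And>r. 0 < r \<Longrightarrow> r \<le> u \<Longrightarrow> h_real p q t s \<le> h_real p q t r"
  shows "h p q u t = h_real p q t s"
proof -
  have "(LEAST v. v \<in> h_obj p q t ` {0..u}) = ereal (h_real p q t s)"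
  proof (rule Least_equality)
    show "ereal (h_real p q t s) \<in> h_obj p q t ` {0..u}"
      using assms(1,2) by (auto simp: image_iff h_obj_eq intro!: bexI[of _ s])
  next
    fix v assume "v \<in> h_obj p q t ` {0..u}"
    then obtain r where r: "v = h_obj p q t r" "0 \<le> r" "r \<le> u" by auto
    show "ereal (h_real p q t s) \<le> v"
      using r assms(3)[of r] by (cases "r = 0") (auto simp: h_obj_0 h_obj_eq)
  qed
  then show ?thesis by (simp add: h_def)
qed

lemma h_eq_linear:
  assumes "0 < u" "\<bar>t\<bar> \<le> u powr (q - 1)"
  shows "h p q u t = h_real p q t u"
  using assms by (intro h_eqI h_real_antimono) auto

text \<open>The unconstrained minimizer is feasible exactly when \<open>\<bar>t\<bar>\<close>
  reaches the threshold. The order flips because \<open>p - 1\<close> is negative.\<close>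

lemma powr_le_conj_iff:
  assumes "0 < u" "t \<noteq> 0"
  shows "\<bar>t\<bar> powr (p - 1) \<le> u \<longleftrightarrow> u powr (q - 1) \<le> \<bar>t\<bar>"
proof -
  have "\<bar>t\<bar> powr (p - 1) \<le> (u powr (q - 1)) powr (p - 1) \<longleftrightarrow> u powr (q - 1) \<le> \<bar>t\<bar>"
    using assms p_less_1 powr_less_mono2_neg[of "p - 1" "\<bar>t\<bar>" "u powr (q - 1)"]
      powr_mono2'[of "p - 1" "u powr (q - 1)" "\<bar>t\<bar>"] by fastforce
  then show ?thesis using assms by (simp add: powr_conj)
qed

lemma h_eq_powr:
  assumes "0 < u" "u powr (q - 1) \<le> \<bar>t\<bar>"
  shows "h p q u t = \<bar>t\<bar> powr p"
proof -
  have t: "t \<noteq> 0" using assms by auto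
  have "h p q u t = h_real p q t (\<bar>t\<bar> powr (p - 1))"
    using t assms by (intro h_eqI) (auto simp: powr_le_conj_iff h_real_eq_powr powr_le_h_real)
  then show ?thesis using t by (simp add: h_real_eq_powr)
qed

lemma h_attained:
  assumes "0 < u"
  obtains s where "0 < s" "s \<le> u" "h p q u t = h_real p q t s"
proof (cases "\<bar>t\<bar> \<le> u powr (q - 1)")
  case True
  then show ?thesis using that[of u] assms by (simp add: h_eq_linear)
next
  case False
  moreover from this have "t \<noteq> 0" by auto
  ultimately show ?thesis
    using that[of "\<bar>t\<bar> powr (p - 1)"] assms
    by (simp add: h_eq_powr powr_le_conj_iff h_real_eq_powr)
qed

lemma h_le_h_real:
  assumes "0 < s" "s \<le> u"
  shows "h p q u t \<le> h_real p q t s"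
proof (cases "\<bar>t\<bar> \<le> u powr (q - 1)")
  case True
  then show ?thesis using assms by (simp add: h_eq_linear h_real_antimono)
next
  case False
  then show ?thesis using assms by (simp add: h_eq_powr powr_le_h_real)
qed

section \<open>Approximation error, Lipschitz constant and lower supports of
  \<open>h\<close>\<close>

lemma powr_le_h: "0 < u \<Longrightarrow> \<bar>t\<bar> powr p \<le> h p q u t"
  by (metis h_attained powr_le_h_real)

lemma h_le_powr_add:
  assumes "0 < u"
  shows "h p q u t \<le> \<bar>t\<bar> powr p + u powr q"
proof (cases "u powr (q - 1) \<le> \<bar>t\<bar>")
  case True
  then show ?thesis using assms by (simp add: h_eq_powr)
next
  case False
  \<comment> \<open>Below the threshold the unconstrained minimizer exceeds \<open>u\<close>;
    multiplying by \<open>\<bar>t\<bar>\<close> gives the bound. The weights \<open>p\<close> and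
    \<open>1 - p\<close> are then both estimated by 1.\<close>
  have "\<bar>t\<bar> * u \<le> \<bar>t\<bar> powr p"
  proof (cases "t = 0")
    case False
    with \<open>\<not> u powr (q - 1) \<le> \<bar>t\<bar>\<close> have "u \<le> \<bar>t\<bar> powr (p - 1)"
      using assms powr_le_conj_iff by fastforce
    then have "\<bar>t\<bar> * u \<le> \<bar>t\<bar> * \<bar>t\<bar> powr (p - 1)" by (intro mult_left_mono) auto
    then show ?thesis using False by (simp add: powr_diff)
  qed auto
  then have "p * (\<bar>t\<bar> * u) \<le> 1 * \<bar>t\<bar> powr p"
    using p_pos p_less_1 assms by (intro mult_mono) auto
  moreover have "(1 - p) * u powr q \<le> 1 * u powr q"
    using p_pos by (intro mult_right_mono) auto
  moreover have "h p q u t = p * (\<bar>t\<bar> * u) + (1 - p) * u powr q"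
    using False assms by (simp add: h_eq_linear h_real_alt mult.assoc)
  ultimately show ?thesis by linarith
qed

lemma h_lipschitz:
  assumes "0 < u"
  shows "(p * u)-lipschitz_on UNIV (h p q u)"
proof -
  have *: "h p q u t \<le> h p q u r + p * u * \<bar>t - r\<bar>" for t r
  proof -
    \<comment> \<open>The slope optimal at \<open>r\<close> serves as a competitor at
      \<open>t\<close>; exchanging the two points gives the other direction.\<close>
    obtain s where s: "0 < s" "s \<le> u" "h p q u r = h_real p q r s"
      using h_attained[OF assms] .
    have "p * s * (\<bar>t\<bar> - \<bar>r\<bar>) \<le> p * s * \<bar>t - r\<bar>"
      using s p_pos by (intro mult_left_mono) auto
    also have "\<dots> \<le> p * u * \<bar>t - r\<bar>"
      using s p_pos by (intro mult_right_mono mult_left_mono) auto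
    finally have "h_real p q t s \<le> h_real p q r s + p * u * \<bar>t - r\<bar>"
      by (simp add: h_real_alt algebra_simps)
    then show ?thesis using h_le_h_real[of s u t] s by simp
  qed
  show ?thesis
  proof (rule lipschitz_onI)
    fix t r :: real
    show "dist (h p q u t) (h p q u r) \<le> p * u * dist t r"
      using *[of t r] *[of r t] by (auto simp: dist_real_def abs_minus_commute abs_le_iff)
  qed (use assms p_pos in auto)
qed

text \<open>From the threshold on, the global minorant \<open>\<bar>r\<bar> powr p\<close> touches
  \<open>h\<close>, so no one-sided derivatives are compared at the threshold itself. Strictly below
  it and away from 0, \<open>h\<close> is locally affine and supports itself. At 0 it has an upward
  kink, so a constant suffices.\<close>

lemma h_lower_support:
  assumes "0 < u"
  obtains m d where "(m has_real_derivative d) (at t)" "m t = h p q u t"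
    "\<forall>\<^sub>F r in nhds t. m r \<le> h p q u r"
proof -
  define a where "a = u powr (q - 1)"
  have a: "a > 0" using assms by (simp add: a_def)
  consider "a \<le> \<bar>t\<bar>" | "\<bar>t\<bar> < a" "t \<noteq> 0" | "t = 0" by linarith
  then show ?thesis
  proof cases
    case 1
    with a have "t \<noteq> 0" by auto
    then have "((\<lambda>r. \<bar>r\<bar> powr p) has_real_derivative (p * \<bar>t\<bar> powr (p - 1) * sgn t)) (at t)"
      by (auto intro!: derivative_eq_intros DERIV_abs_real)
    then show ?thesis
      using 1 assms by (intro that) (auto simp: a_def h_eq_powr powr_le_h)
  next
    case 2
    have "\<forall>\<^sub>F r in nhds t. \<bar>r\<bar> < a"
      using 2 by (intro order_tendstoD(2)[OF tendsto_rabs[OF filterlim_ident]])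
    then have "\<forall>\<^sub>F r in nhds t. h_real p q r u \<le> h p q u r"
      by eventually_elim (use assms in \<open>simp add: a_def h_eq_linear\<close>)
    moreover have "((\<lambda>r. h_real p q r u) has_real_derivative (p * u * sgn t)) (at t)"
      unfolding h_real_alt using 2 by (auto intro!: derivative_eq_intros DERIV_abs_real)
    ultimately show ?thesis
      using 2 assms by (intro that[of "\<lambda>r. h_real p q r u"]) (auto simp: a_def h_eq_linear)
  next
    case 3
    have "\<forall>\<^sub>F r in nhds t. \<bar>r\<bar> < a"
      using 3 a by (intro order_tendstoD(2)[OF tendsto_rabs[OF filterlim_ident]]) auto
    then have "\<forall>\<^sub>F r in nhds t. h p q u 0 \<le> h p q u r"
      by eventually_elim (use assms p_pos in \<open>simp add: a_def h_eq_linear h_real_alt\<close>)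
    then show ?thesis
      using 3 by (intro that[of "\<lambda>_. h p q u 0" 0]) auto
  qed
qed

end

section \<open>Lower supports and the Clarke derivative\<close>

text \<open>With base point \<open>x\<close>, the quotients of \<open>g\<close> dominate those of
  \<open>m\<close>, which tend to \<open>D v\<close>. A joint upper limit is at least the upper
  limit along this restricted approach.\<close>

lemma clarke_deriv_ge_lower_support:
  fixes g m :: "'a::euclidean_space \<Rightarrow> real"
  assumes der: "(m has_derivative D) (at x)" and eq: "m x = g x"
    and le: "\<forall>\<^sub>F y in nhds x. m y \<le> g y"
  shows "ereal (D v) \<le> clarke_deriv g x v"
proof (rule ccontr)
  assume "\<not> ereal (D v) \<le> clarke_deriv g x v"
  then obtain c where c: "clarke_deriv g x v < c" "c < ereal (D v)"
    using dense[of "clarke_deriv g x v" "ereal (D v)"] by (auto simp: not_le)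
  define Q where "Q = (\<lambda>t. (g (x + t *\<^sub>R v) - g x) / t)"
  have lin: "((\<lambda>t. x + t *\<^sub>R v) has_derivative (\<lambda>t. t *\<^sub>R v)) (at 0)"
    by (auto intro!: derivative_eq_intros)
  have "((\<lambda>t. m (x + t *\<^sub>R v)) has_derivative (\<lambda>t. D (t *\<^sub>R v))) (at 0)"
    using has_derivative_compose[OF lin, of m D] der by simp
  moreover have "D (t *\<^sub>R v) = D v * t" for t
    using has_derivative_linear[OF der] by (simp add: linear_scale)
  ultimately have "((\<lambda>t. m (x + t *\<^sub>R v)) has_real_derivative D v) (at 0)"
    by (simp add: has_field_derivative_def)
  then have "((\<lambda>t. (m (x + t *\<^sub>R v) - m x) / t) \<longlongrightarrow> D v) (at_right 0)"
    by (auto simp: DERIV_def intro: filterlim_mono at_le)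
  then have "((\<lambda>t. ereal ((m (x + t *\<^sub>R v) - m x) / t)) \<longlongrightarrow> ereal (D v)) (at_right 0)"
    by (rule tendsto_ereal)
  then have 1: "\<forall>\<^sub>F t in at_right 0. c < ereal ((m (x + t *\<^sub>R v) - m x) / t)"
    using c(2) by (rule order_tendstoD)
  have "((\<lambda>t. x + t *\<^sub>R v) \<longlongrightarrow> x + 0 *\<^sub>R v) (at_right 0)"
    by (intro tendsto_intros)
  then have lim: "((\<lambda>t. x + t *\<^sub>R v) \<longlongrightarrow> x) (at_right 0)" by simp
  have 2: "\<forall>\<^sub>F t in at_right 0. m (x + t *\<^sub>R v) \<le> g (x + t *\<^sub>R v)"
    by (rule eventually_compose_filterlim[OF le lim])
  have 3: "\<forall>\<^sub>F t in at_right 0. (0::real) < t"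
    by (simp add: eventually_at_right_less)
  have 4: "\<forall>\<^sub>F t in at_right 0. c < ereal (Q t)"
    using 1 2 3
  proof eventually_elim
    case (elim t)
    have "(m (x + t *\<^sub>R v) - m x) / t \<le> Q t"
      using elim eq by (simp add: Q_def divide_right_mono)
    then show ?case using elim by (meson ereal_less_eq(3) less_le_trans)
  qed
  \<comment> \<open>Freezing \<open>y = x\<close> is a legitimate approach because
    \<open>nhds x\<close>, unlike \<open>at x\<close>, does not exclude \<open>x\<close>.\<close>
  have tup: "filterlim (\<lambda>t. (x, t)) (nhds x \<times>\<^sub>F at_right 0) (at_right (0::real))"
    by (intro filterlim_Pair tendsto_const filterlim_ident)
  have "\<forall>\<^sub>F z in nhds x \<times>\<^sub>F at_right 0.
      (case z of (y, t) \<Rightarrow> ereal ((g (y + t *\<^sub>R v) - g y) / t)) < c"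
    using c(1) unfolding clarke_deriv_def by (rule Limsup_lessD)
  then have "\<forall>\<^sub>F t in at_right 0. ereal (Q t) < c"
    using tup by (auto simp: filterlim_iff Q_def)
  with 4 have "\<forall>\<^sub>F t in at_right (0::real). False"
    by eventually_elim simp
  then show False by (simp add: trivial_limit_at_right_real)
qed

section \<open>Lipschitz estimates for the two summands\<close>

lemma lipschitz_on_sum_components:
  fixes k :: "real \<Rightarrow> real"
  assumes "C-lipschitz_on UNIV k" "0 \<le> lam"
  shows "(lam * (real CARD('n) * C))-lipschitz_on S (\<lambda>x::real ^ 'n. lam * (\<Sum>i\<in>UNIV. k (x $ i)))"
proof (rule lipschitz_onI)
  have C: "C \<ge> 0" using assms(1) by (rule lipschitz_on_nonneg)
  then show "0 \<le> lam * (real CARD('n) * C)" using assms(2) by simp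
  fix x y :: "real ^ 'n"
  have "dist (\<Sum>i\<in>UNIV. k (x $ i)) (\<Sum>i\<in>UNIV. k (y $ i)) \<le> (\<Sum>i\<in>UNIV. \<bar>k (x $ i) - k (y $ i)\<bar>)"
    by (simp add: dist_real_def sum_abs flip: sum_subtractf)
  also have "\<dots> \<le> (\<Sum>i\<in>(UNIV::'n set). C * dist x y)"
  proof (rule sum_mono)
    fix i
    have "\<bar>k (x $ i) - k (y $ i)\<bar> \<le> C * dist (x $ i) (y $ i)"
      using lipschitz_onD[OF assms(1)] by (simp add: dist_real_def)
    also have "\<dots> \<le> C * dist x y" using C by (intro mult_left_mono dist_vec_nth_le)
    finally show "\<bar>k (x $ i) - k (y $ i)\<bar> \<le> C * dist x y" .
  qed
  finally have "lam * dist (\<Sum>i\<in>UNIV. k (x $ i)) (\<Sum>i\<in>UNIV. k (y $ i))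
      \<le> lam * (real CARD('n) * C * dist x y)"
    using assms(2) by (intro mult_left_mono) (auto simp: mult.assoc)
  then show "dist (lam * (\<Sum>i\<in>UNIV. k (x $ i))) (lam * (\<Sum>i\<in>UNIV. k (y $ i)))
      \<le> lam * (real CARD('n) * C) * dist x y"
    using assms(2) by (simp add: dist_real_def abs_mult mult.assoc flip: right_diff_distrib)
qed

text \<open>On the unit ball around \<open>x\<close> the gradient has norm at most
  \<open>norm (grad x) + L\<close>, and a derivative bounded on a convex set yields a Lipschitz
  constant.\<close>

lemma lipschitz_near_GDERIV:
  fixes f :: "'a::euclidean_space \<Rightarrow> real"
  assumes der: "\<And>x. GDERIV f x :> grad x" and lip: "L-lipschitz_on UNIV grad"
  shows "lipschitz_near f x"
proof -
  define B where "B = norm (grad x) + L"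
  have L: "L \<ge> 0" using lip by (rule lipschitz_on_nonneg)
  have "B-lipschitz_on (ball x 1) f"
  proof (rule bounded_derivative_imp_lipschitz)
    show "(f has_derivative (\<lambda>v. v \<bullet> grad y)) (at y within ball x 1)" for y
      using der[of y] by (simp add: gderiv_def has_derivative_at_withinI)
    show "onorm (\<lambda>v. v \<bullet> grad y) \<le> B" if "y \<in> ball x 1" for y
    proof (rule onorm_le)
      fix v :: 'a
      have "norm (grad y - grad x) \<le> L * dist y x"
        using lipschitz_onD[OF lip, of y x] by (simp add: dist_norm)
      also have "\<dots> \<le> L * 1"
        using that L by (intro mult_left_mono) (auto simp: dist_commute)
      finally have "norm (grad y) \<le> B"
        using norm_triangle_sub[of "grad y" "grad x"] by (simp add: B_def)
      then have "norm v * norm (grad y) \<le> norm v * B" by (rule mult_left_mono) simp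
      then show "norm (v \<bullet> grad y) \<le> B * norm v"
        using Cauchy_Schwarz_ineq2[of v "grad y"] by (simp add: mult.commute)
    qed
  qed (use L in \<open>auto simp: B_def\<close>)
  then show ?thesis unfolding lipschitz_near_def by (intro exI[of _ "1::real"]) auto
qed

section \<open>Assembly of the three claims\<close>

theorem proposition2p6:
  fixes f :: "real ^ 'n \<Rightarrow> real" and grad :: "real ^ 'n \<Rightarrow> real ^ 'n"
    and lam p q L\<^sub>f \<epsilon> :: real
  assumes "lam > 0" and "0 < p" and "p < 1" and "1 / p + 1 / q = 1"
    and "\<And>x. GDERIV f x :> grad x" and "continuous_on UNIV grad"
    and "bdd_below (range f)"
    and "L\<^sub>f-lipschitz_on UNIV grad"
    and "\<epsilon> > 0"
  shows "(\<forall>x. 0 \<le> F_eps f lam p q \<epsilon> x - F f lam p x \<and> F_eps f lam p q \<epsilon> x - F f lam p x \<le> \<epsilon>)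
       \<and> ((\<forall>x. lipschitz_near (F_eps f lam p q \<epsilon>) x)
          \<and> ((\<exists>K. K-lipschitz_on UNIV f) \<longrightarrow> (\<exists>K. K-lipschitz_on UNIV (F_eps f lam p q \<epsilon>))))
       \<and> (\<forall>x. \<exists>S. has_clarke_subdifferential (F_eps f lam p q \<epsilon>) S x \<and> S \<noteq> {})"
proof -
  interpret conjugate_exponents p q using assms by unfold_locales
  define u where "u = u_eps CARD('n) lam q \<epsilon>"
  \<comment> \<open>Each coordinate contributes an error of at most \<open>u powr q\<close>; the
    choice of \<open>u\<close> makes these errors, summed and scaled by \<open>lam\<close>, at most
    \<open>\<epsilon>\<close>.\<close>
  have u: "u > 0" and uq: "lam * (real CARD('n) * u powr q) = \<epsilon>"
    using assms q_neg by (simp_all add: u_def u_eps_def powr_powr)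
  define G where "G = F_eps f lam p q \<epsilon>"
  have G: "G = (\<lambda>x. f x + lam * (\<Sum>i\<in>UNIV. h p q u (x $ i)))"
    by (simp add: G_def F_eps_def u_def fun_eq_iff)
  have approx: "0 \<le> G x - F f lam p x \<and> G x - F f lam p x \<le> \<epsilon>" for x
  proof -
    have "(\<Sum>i\<in>UNIV. \<bar>x $ i\<bar> powr p) \<le> (\<Sum>i\<in>UNIV. h p q u (x $ i))"
      by (intro sum_mono powr_le_h u)
    then have "lam * (\<Sum>i\<in>UNIV. \<bar>x $ i\<bar> powr p) \<le> lam * (\<Sum>i\<in>UNIV. h p q u (x $ i))"
      using assms(1) by simp
    moreover have "(\<Sum>i\<in>UNIV. h p q u (x $ i)) \<le> (\<Sum>i\<in>UNIV. \<bar>x $ i\<bar> powr p + u powr q)"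
      by (intro sum_mono h_le_powr_add u)
    then have "lam * (\<Sum>i\<in>UNIV. h p q u (x $ i))
        \<le> lam * ((\<Sum>i\<in>UNIV. \<bar>x $ i\<bar> powr p) + real CARD('n) * u powr q)"
      using assms(1) by (simp add: sum.distrib)
    ultimately show ?thesis
      using uq by (simp add: G F_def distrib_left)
  qed
  note lip_h = lipschitz_on_sum_components[OF h_lipschitz[OF u] less_imp_le[OF assms(1)]]
  have near: "lipschitz_near G x" for x
  proof -
    obtain e L where "e > 0" "L-lipschitz_on (ball x e) f"
      using lipschitz_near_GDERIV[OF assms(5,8), of x] by (auto simp: lipschitz_near_def)
    then show ?thesis
      unfolding G lipschitz_near_def using lipschitz_on_add[OF _ lip_h] by blast
  qed
  have glob: "\<exists>K. K-lipschitz_on UNIV G" if "K-lipschitz_on UNIV f" for K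
    unfolding G using lipschitz_on_add[OF that lip_h] by blast
  have clarke: "\<exists>S. has_clarke_subdifferential G S x \<and> S \<noteq> {}" for x
  proof -
    have "\<forall>i. \<exists>m d. (m has_real_derivative d) (at (x $ i)) \<and> m (x $ i) = h p q u (x $ i)
        \<and> (\<forall>\<^sub>F r in nhds (x $ i). m r \<le> h p q u r)"
      by (metis h_lower_support[OF u])
    then obtain m d where m: "\<And>i. (m i has_real_derivative d i) (at (x $ i))"
      "\<And>i. m i (x $ i) = h p q u (x $ i)"
      "\<And>i. \<forall>\<^sub>F r in nhds (x $ i). m i r \<le> h p q u r"
      by metis
    \<comment> \<open>Replacing each \<open>h\<close> by its support at \<open>x $ i\<close> gives a
      function that is differentiable at \<open>x\<close> and touches \<open>G\<close> there from
      below; \<open>\<xi>\<close> is its gradient.\<close>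
    define M where "M = (\<lambda>y. f y + lam * (\<Sum>i\<in>UNIV. m i (y $ i)))"
    define \<xi> where "\<xi> = grad x + lam *\<^sub>R (\<chi> i. d i)"
    have "((\<lambda>y. m i (y $ i)) has_derivative (\<lambda>v. d i * v $ i)) (at x)" for i
      using has_derivative_compose[OF bounded_linear_imp_has_derivative[OF bounded_linear_vec_nth]]
        m(1)[of i] by (auto simp: has_field_derivative_def)
    moreover have "(f has_derivative (\<lambda>v. v \<bullet> grad x)) (at x)"
      using assms(5)[of x] by (simp add: gderiv_def)
    ultimately have "(M has_derivative (\<lambda>v. v \<bullet> grad x + lam * (\<Sum>i\<in>UNIV. d i * v $ i))) (at x)"
      unfolding M_def by (intro has_derivative_add has_derivative_mult_right has_derivative_sum)
    moreover have "v \<bullet> grad x + lam * (\<Sum>i\<in>UNIV. d i * v $ i) = \<xi> \<bullet> v" for v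
      by (simp add: \<xi>_def inner_vec_def sum_distrib_left sum.distrib algebra_simps)
    ultimately have "(M has_derivative (\<lambda>v. \<xi> \<bullet> v)) (at x)" by simp
    moreover have "M x = G x" by (simp add: M_def G m(2))
    moreover have "\<forall>\<^sub>F y in nhds x. M y \<le> G y"
    proof -
      \<comment> \<open>The one-dimensional neighbourhoods pull back along the coordinate
        projections, and finitely many of them intersect in a neighbourhood of
        \<open>x\<close>.\<close>
      have "\<forall>\<^sub>F y in nhds x. \<forall>i. m i (y $ i) \<le> h p q u (y $ i)"
      proof (rule eventually_all_finite)
        fix i
        have "((\<lambda>y. y $ i) \<longlongrightarrow> x $ i) (nhds x)" by (intro tendsto_vec_nth filterlim_ident)
        then show "\<forall>\<^sub>F y in nhds x. m i (y $ i) \<le> h p q u (y $ i)"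
          by (rule eventually_compose_filterlim[OF m(3)])
      qed
      then show ?thesis
        by eventually_elim (use assms(1) in \<open>auto simp: M_def G intro!: sum_mono\<close>)
    qed
    ultimately have "ereal (\<xi> \<bullet> v) \<le> clarke_deriv G x v" for v
      by (rule clarke_deriv_ge_lower_support)
    \<comment> \<open>The set \<open>S\<close> is forced by the definition: \<open>near\<close>
      makes it the subdifferential, and \<open>\<xi>\<close> is a member.\<close>
    then show ?thesis
      using near by (auto simp: has_clarke_subdifferential_def)
  qed
  show ?thesis using approx near glob clarke unfolding G_def by blast
qed

end
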